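(* Let $r_1,\dots,r_n\geqslant1$ be real numbers and let $a_0$ be a number with $1<a_0\leqslant2$ such that $x^{r_1+\cdots+r_n}\geqslant x^{r_1}+\cdots+x^{r_n}$ for every $x\geqslant a_0$. Then for every $a\geqslant a_0$ the function $g(x)=a^x$ satisfies the following condition: there exists $\alpha_0>0$ such that for every $\alpha\geqslant\alpha_0$ there exists $\beta\in\mathbb R_+$ such that for all non-zero natural numbers $y_1,\dots,y_m,z$ with $y_1+\cdots+y_m\leqslant z$ one has $\sum_{j=1}^m g(\alpha y_j)\leqslant g(\beta z)$.
   Context: The condition is imposed on non-decreasing functions $g:\mathbb R_+\to\mathbb R_+$. The number $a_0$ is the one whose existence is asserted, for given real numbers $r_1,\dots,r_n\geqslant1$, in the remark preceding the proposition in the source. *)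

theory Defs
  imports Complex_Main
begin

text \<open>
  A function from the nonnegative reals to the nonnegative reals is represented by a
  function \<open>g :: real \<Rightarrow> real\<close>, of which only the values on \<open>{0..}\<close> matter. The first two
  conjuncts express that \<open>g\<close> is non-decreasing and nonnegative there.
\<close>

definition growth_condition :: "(real \<Rightarrow> real) \<Rightarrow> bool" where
  "growth_condition g \<longleftrightarrow>
     (\<forall>x\<ge>0. g x \<ge> 0) \<and> mono_on {0..} g \<and>
     (\<exists>\<alpha>\<^sub>0>0. \<forall>\<alpha>\<ge>\<alpha>\<^sub>0. \<exists>\<beta>\<ge>0.
        \<forall>(m::nat) (y::nat \<Rightarrow> nat) (z::nat).
          (\<forall>j\<in>{1..m}. y j \<noteq> 0) \<and> z \<noteq> 0 \<and> (\<Sum>j=1..m. y j) \<le> z \<longrightarrow>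
          (\<Sum>j=1..m. g (\<alpha> * real (y j))) \<le> g (\<beta> * real z))"

end

theory Submission
  imports Defs
begin

text \<open>
  A sum \<open>y\<^sub>1 + \<dots> + y\<^sub>m \<le> z\<close> of non-zero natural numbers has \<open>m \<le> z \<le> 2\<^sup>z\<close> terms, each at
  most \<open>z\<close>. Hence the sum of the \<open>a powr (\<alpha> y\<^sub>j)\<close> is at most \<open>2\<^sup>z \<cdot> a powr (\<alpha> z)\<close>, which is
  \<open>a powr (\<beta> z)\<close> for \<open>\<beta> = \<alpha> + log a 2\<close>.
\<close>

lemma growth_condition_powr:
  fixes a :: real
  assumes a: "1 < a"
  shows "growth_condition (\<lambda>x. a powr x)"
proof -
  have bound: "(\<Sum>j=1..m. a powr (\<alpha> * real (y j))) \<le> a powr ((\<alpha> + log a 2) * real z)"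
    if \<alpha>: "1 \<le> \<alpha>" and y: "\<forall>j\<in>{1..m}. y j \<noteq> 0" and yz: "(\<Sum>j=1..m. y j) \<le> z"
    for \<alpha> :: real and m z :: nat and y :: "nat \<Rightarrow> nat"
  proof -
    have "m = (\<Sum>j=1..m. 1::nat)" by simp
    also have "\<dots> \<le> (\<Sum>j=1..m. y j)"
      using y by (intro sum_mono) (simp add: Suc_leI)
    finally have "m \<le> z" using yz by simp
    \<comment> \<open>This crude bound on the number of terms is exponential in \<open>z\<close>, so
      it can be absorbed into an exponent linear in \<open>z\<close>.\<close>
    then have "m \<le> 2 ^ z"
      using less_exp[of z] by linarith
    then have m: "real m \<le> 2 ^ z"
      by (metis of_nat_le_iff of_nat_numeral of_nat_power)
    have "y j \<le> z" if "j \<in> {1..m}" for j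
      using member_le_sum[of j "{1..m}" y] that yz by simp
    then have "(\<Sum>j=1..m. a powr (\<alpha> * real (y j))) \<le> (\<Sum>j=1..m. a powr (\<alpha> * real z))"
      using a \<alpha> by (intro sum_mono powr_mono mult_left_mono) auto
    also have "\<dots> = real m * a powr (\<alpha> * real z)" by simp
    also have "\<dots> \<le> 2 ^ z * a powr (\<alpha> * real z)"
      using m by (intro mult_right_mono) auto
    \<comment> \<open>The base change \<open>a powr (log a 2) = 2\<close> is the source of the
      summand \<open>log a 2\<close> in \<beta>.\<close>
    also have "2 ^ z = a powr (log a 2 * real z)"
      using a by (simp add: powr_powr[symmetric] powr_realpow)
    finally show ?thesis
      by (simp add: powr_add[symmetric] algebra_simps)
  qed
  have "mono_on {0..} (\<lambda>x. a powr x)"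
    using a by (intro mono_onI powr_mono) auto
  moreover have "0 \<le> \<alpha> + log a 2" if "1 \<le> \<alpha>" for \<alpha>
    using a that by (simp add: add_nonneg_nonneg)
  \<comment> \<open>The threshold \<open>\<alpha>\<^sub>0 = 1\<close> keeps \<alpha> nonnegative,
    which lets \<open>y j\<close> be replaced by \<open>z\<close> in the exponent and makes \<beta>
    \<ge> 0.\<close>
  ultimately show ?thesis
    unfolding growth_condition_def
    using bound by (intro conjI exI[of _ "1::real"]) (auto intro!: exI[of _ "_ + log a 2"])
qed

theorem proposition5p1p12:
  fixes n :: nat and r :: "nat \<Rightarrow> real" and a\<^sub>0 a :: real
  assumes "\<forall>i\<in>{1..n}. r i \<ge> 1"
    and "1 < a\<^sub>0" and "a\<^sub>0 \<le> 2"
    and "\<forall>x\<ge>a\<^sub>0. x powr (\<Sum>i=1..n. r i) \<ge> (\<Sum>i=1..n. x powr r i)"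
    and "a \<ge> a\<^sub>0"
  shows "growth_condition (\<lambda>x. a powr x)"
  using assms by (intro growth_condition_powr) simp

end
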